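(* Let $f\colon\omega\to\omega$ be a unary total computable function which is not a quasi-block function. Then the degree spectrum of $f$ on $(\omega,<)$ is equal to the set of all c.e. Turing degrees.
   Context: $f$ is a quasi-block function if there are arbitrarily long finite initial segments of $(\omega,<)$ closed under $f$ (i.e. for every $n$ there is $m\ge n$ with $f(x)\le m$ for all $x\le m$). A computable copy of $(\omega,<)$ is $(\omega,\prec)$ with $\prec$ computable and isomorphic to $(\omega,<)$; $f_{\mathcal A}$ is the image of the graph of $f$ in the copy $\mathcal A$ under the isomorphism; the degree spectrum of $f$ is the set of Turing degrees of $f_{\mathcal A}$ over all computable copies $\mathcal A$. *)

theory Defs
  imports "HOL-Library.Nat_Bijection"
begin

datatype recf =
    Zero
  | Succ
  | Proj nat
  | Query
  | Comp recf "recf list"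
  | PrimRec recf recf
  | Mu recf

text \<open>
  \<open>eval A p xs y\<close>: the partial recursive scheme \<open>p\<close>, run with oracle \<open>A\<close> on the argument list
  \<open>xs\<close>, converges with value \<open>y\<close>. Divergence is the absence of such a \<open>y\<close>. In \<open>PrimRec\<close> and \<open>Mu\<close>
  the recursion, respectively search, variable is the first argument, and minimization diverges
  when the body diverges before the first zero. Schemes carry no fixed arity.
\<close>

inductive eval :: "nat set \<Rightarrow> recf \<Rightarrow> nat list \<Rightarrow> nat \<Rightarrow> bool" for A :: "nat set" where
  eval_Zero: "eval A Zero xs 0"
| eval_Succ: "eval A Succ [x] (Suc x)"
| eval_Proj: "i < length xs \<Longrightarrow> eval A (Proj i) xs (xs ! i)"
| eval_Query: "eval A Query [x] (of_bool (x \<in> A))"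
| eval_Comp: "list_all2 (\<lambda>g y. eval A g xs y) gs ys \<Longrightarrow> eval A h ys z \<Longrightarrow> eval A (Comp h gs) xs z"
| eval_PrimRec_0: "eval A g xs y \<Longrightarrow> eval A (PrimRec g h) (0 # xs) y"
| eval_PrimRec_Suc: "eval A (PrimRec g h) (n # xs) y \<Longrightarrow> eval A h (n # y # xs) z
    \<Longrightarrow> eval A (PrimRec g h) (Suc n # xs) z"
| eval_Mu: "eval A g (n # xs) 0 \<Longrightarrow> (\<forall>k<n. \<exists>y>0. eval A g (k # xs) y) \<Longrightarrow> eval A (Mu g) xs n"

inductive_cases eval_ZeroE: "eval A Zero xs y"
inductive_cases eval_SuccE: "eval A Succ xs y"
inductive_cases eval_ProjE: "eval A (Proj i) xs y"
inductive_cases eval_QueryE: "eval A Query xs y"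
inductive_cases eval_CompE: "eval A (Comp h gs) xs y"
inductive_cases eval_PrimRec_0E: "eval A (PrimRec g h) (0 # xs) y"
inductive_cases eval_PrimRec_SucE: "eval A (PrimRec g h) (Suc n # xs) y"
inductive_cases eval_MuE: "eval A (Mu g) xs y"

lemma eval_deterministic: "eval A p xs y \<Longrightarrow> eval A p xs z \<Longrightarrow> y = z"
proof (induction arbitrary: z rule: eval.induct)
  case (eval_Comp xs gs ys h w)
  from eval_Comp.prems obtain ys' where
    ys': "list_all2 (\<lambda>g y. eval A g xs y) gs ys'" "eval A h ys' z"
    by (blast elim: eval_CompE)
  have "ys = ys'"
    using eval_Comp.IH(1) ys'(1)
    by (auto simp: list_all2_conv_all_nth intro!: nth_equalityI)
  then show ?case using eval_Comp.IH ys'(2) by blast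
next
  case (eval_PrimRec_Suc g h n xs y w)
  from eval_PrimRec_Suc.prems obtain y' where
    "eval A (PrimRec g h) (n # xs) y'" "eval A h (n # y' # xs) z"
    by (blast elim: eval_PrimRec_SucE)
  then show ?case using eval_PrimRec_Suc.IH by metis
next
  case (eval_Mu g n xs)
  from eval_Mu.prems have
    z: "eval A g (z # xs) 0" "\<forall>k<z. \<exists>y>0. eval A g (k # xs) y"
    by (auto elim: eval_MuE)
  show ?case
  proof (rule linorder_cases[of n z])
    assume "n < z"
    then obtain y where "y > 0" "eval A g (n # xs) y" using z(2) by blast
    then show ?thesis using eval_Mu.IH(1) by fastforce
  next
    assume "z < n"
    then show ?thesis using eval_Mu.IH(2) z(1) by fastforce
  qed
qed (blast elim: eval_ZeroE eval_SuccE eval_ProjE eval_QueryE eval_PrimRec_0E)+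

text \<open>
  Computability without an oracle is computability with the empty oracle, whose queries all
  return \<open>0\<close>.
\<close>

definition computable_fun :: "(nat \<Rightarrow> nat) \<Rightarrow> bool" where
  "computable_fun f \<longleftrightarrow> (\<exists>p. \<forall>x. eval {} p [x] (f x))"

definition computable_rel :: "(nat \<Rightarrow> nat \<Rightarrow> bool) \<Rightarrow> bool" where
  "computable_rel R \<longleftrightarrow> (\<exists>p. \<forall>x y. eval {} p [x, y] (of_bool (R x y)))"

definition ce_set :: "nat set \<Rightarrow> bool" where
  "ce_set W \<longleftrightarrow> W = {} \<or> (\<exists>g. computable_fun g \<and> W = range g)"

definition turing_reducible :: "nat set \<Rightarrow> nat set \<Rightarrow> bool" where
  "turing_reducible A B \<longleftrightarrow> (\<exists>p. \<forall>x. eval B p [x] (of_bool (x \<in> A)))"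

definition turing_equivalent :: "nat set \<Rightarrow> nat set \<Rightarrow> bool" where
  "turing_equivalent A B \<longleftrightarrow> turing_reducible A B \<and> turing_reducible B A"

definition turing_degree :: "nat set \<Rightarrow> nat set set" where
  "turing_degree A = {B. turing_equivalent B A}"

definition ce_degrees :: "nat set set set" where
  "ce_degrees = {turing_degree W | W. ce_set W}"

definition quasi_block :: "(nat \<Rightarrow> nat) \<Rightarrow> bool" where
  "quasi_block f \<longleftrightarrow> (\<forall>n. \<exists>m\<ge>n. \<forall>x\<le>m. f x \<le> m)"

definition omega_iso :: "(nat \<Rightarrow> nat) \<Rightarrow> (nat \<Rightarrow> nat \<Rightarrow> bool) \<Rightarrow> bool" where
  "omega_iso h R \<longleftrightarrow> bij h \<and> (\<forall>x y. x < y \<longleftrightarrow> R (h x) (h y))"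

text \<open>The image of the graph of \<open>f\<close> under \<open>h\<close>, a binary relation coded as a set of numbers.\<close>

definition graph_image :: "(nat \<Rightarrow> nat) \<Rightarrow> (nat \<Rightarrow> nat) \<Rightarrow> nat set" where
  "graph_image h f = {prod_encode (h x, h (f x)) | x. True}"

text \<open>
  The isomorphism \<open>h\<close> from the standard order onto a copy \<open>R\<close> is unique, so quantifying over
  \<open>h\<close> below contributes exactly one degree for every computable copy.
\<close>

definition degree_spectrum :: "(nat \<Rightarrow> nat) \<Rightarrow> nat set set set" where
  "degree_spectrum f =
     {turing_degree (graph_image h f) | h R. computable_rel R \<and> omega_iso h R}"

end

theory Submission
  imports Defs "HOL-Library.Infinite_Set"
begin

text \<open>
  Let \<open>h\<close> be the isomorphism from \<open>\<omega>\<close> onto a computable copy. Clearly \<open>f\<^sub>A\<close> is computable from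
  \<open>h\<close>. Conversely, once \<open>h k\<close> is known, \<open>h\<close> is known on \<open>{..k}\<close>: wait until \<open>k\<close> predecessors of
  \<open>h k\<close> have shown up. If \<open>k\<close> is large, some \<open>x \<le> k\<close> has \<open>f x > k\<close>, and \<open>f\<^sub>A\<close> maps \<open>h x\<close> to
  \<open>h (f x)\<close>, so that iterating computes \<open>h\<close> from \<open>f\<^sub>A\<close>. Hence \<open>f\<^sub>A\<close> and \<open>h\<close> are Turing equivalent.

  The isomorphism \<open>h\<close> has the degree of the c.e. set of all \<open>(a, n)\<close> such that \<open>a\<close> has at least
  \<open>n\<close> predecessors. For the converse, every c.e. set \<open>W\<close> is equivalent to the range of an
  injective computable function \<open>key\<close>, and the copy ordered by \<open>key a < key b\<close> has an isomorphism
  equivalent to this range.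
\<close>

lemma Least_eq: "(LEAST n. n = (k::nat)) = k"
  by (rule Least_equality) auto

section \<open>Relative computability\<close>

text \<open>
  A single program computes \<open>F e\<close> from the values \<open>G e\<close> of the functions \<open>G\<close> in the list \<open>Gs\<close>.
  The environment \<open>e\<close> may range over any type, so invariants linking the inputs can be built
  into the \<open>Gs\<close>; minimization then only has to terminate on inputs that occur.
\<close>

definition computes :: "nat set \<Rightarrow> ('e \<Rightarrow> nat) list \<Rightarrow> ('e \<Rightarrow> nat) \<Rightarrow> bool" where
  "computes A Gs F \<longleftrightarrow> (\<exists>p. \<forall>e. eval A p (map (\<lambda>G. G e) Gs) (F e))"

abbreviation decides :: "nat set \<Rightarrow> ('e \<Rightarrow> nat) list \<Rightarrow> ('e \<Rightarrow> bool) \<Rightarrow> bool" where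
  "decides A Gs P \<equiv> computes A Gs (\<lambda>e. of_bool (P e))"

lemma computable_fun_iff: "computable_fun f \<longleftrightarrow> computes {} [\<lambda>x. x] f"
  by (simp add: computable_fun_def computes_def)

lemma computable_rel_iff: "computable_rel R \<longleftrightarrow> decides {} [fst, snd] (\<lambda>u. R (fst u) (snd u))"
  by (simp add: computable_rel_def computes_def)

lemma turing_reducible_iff: "turing_reducible B A \<longleftrightarrow> decides A [\<lambda>x. x] (\<lambda>x. x \<in> B)"
  by (simp add: turing_reducible_def computes_def)

lemma computes_var [simp]: "F \<in> set Gs \<Longrightarrow> computes A Gs F"
  unfolding computes_def in_set_conv_nth
  by (metis eval_Proj length_map nth_map)

lemma computes_cut:
  assumes F: "computes A Hs F" and Hs: "\<And>H. H \<in> set Hs \<Longrightarrow> computes A Gs H"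
  shows "computes A Gs F"
proof -
  obtain p where p: "\<And>e. eval A p (map (\<lambda>H. H e) Hs) (F e)"
    using F by (auto simp: computes_def)
  obtain q where q: "\<And>H e. H \<in> set Hs \<Longrightarrow> eval A (q H) (map (\<lambda>G. G e) Gs) (H e)"
    using Hs unfolding computes_def by metis
  have "eval A (Comp p (map q Hs)) (map (\<lambda>G. G e) Gs) (F e)" for e
    by (rule eval_Comp[OF _ p]) (auto simp: list_all2_conv_all_nth q)
  then show ?thesis unfolding computes_def by blast
qed

text \<open>The program sees only the values of its inputs, not how they are parametrised. A program
  for the canonical inputs \<open>fst\<close> and \<open>snd\<close> thus transfers to arbitrary
  ones.\<close>

lemma computes_reindex: "computes A Gs F \<Longrightarrow> computes A (map (\<lambda>G e. G (t e)) Gs) (\<lambda>e. F (t e))"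
  by (auto simp: computes_def comp_def)

lemma computes_mono: "computes A Hs F \<Longrightarrow> set Hs \<subseteq> set Gs \<Longrightarrow> computes A Gs F"
  using computes_cut computes_var by blast

lemma computes_lift:
  "computes A Gs F \<Longrightarrow> computes A (H # map (\<lambda>G u. G (snd u)) Gs) (\<lambda>u. F (snd u))"
  by (rule computes_mono[OF computes_reindex]) auto

lemma computes_app:
  assumes "computes A [\<lambda>x. x] f" "computes A Gs F"
  shows "computes A Gs (\<lambda>e. f (F e))"
  using computes_cut[OF computes_reindex[OF assms(1), of F], of Gs] assms(2) by auto

lemma computes_app2:
  assumes "computes A [fst, snd] (\<lambda>u. f (fst u) (snd u))" "computes A Gs F" "computes A Gs G"
  shows "computes A Gs (\<lambda>e. f (F e) (G e))"
  using computes_cut[OF computes_reindex[OF assms(1), of "\<lambda>e. (F e, G e)"], of Gs] assms(2,3)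
  by auto

lemma computes_Suc:
  assumes "computes A Gs F" shows "computes A Gs (\<lambda>e. Suc (F e))"
proof (rule computes_app[OF _ assms])
  show "computes A [\<lambda>x. x] Suc"
    unfolding computes_def by (auto intro: eval_Succ)
qed

lemma decides_oracle:
  assumes "computes A Gs F" shows "decides A Gs (\<lambda>e. F e \<in> A)"
proof (rule computes_app[OF _ assms])
  show "decides A [\<lambda>x. x] (\<lambda>x. x \<in> A)"
    unfolding computes_def using eval_Query by (metis list.simps(8,9))
qed

lemma computes_const [simp]: "computes A Gs (\<lambda>_. n)"
proof (induction n)
  case 0 show ?case unfolding computes_def by (auto intro: eval_Zero)
next
  case (Suc n) then show ?case by (rule computes_Suc)
qed

text \<open>\<open>S\<close> is given as a function of stage and environment, so the step receives
  the true previous value and may rely on facts about it. In the step, \<open>fst u\<close> is the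
  stage and \<open>snd u\<close> the environment, in the order in which \<open>PrimRec\<close>
  passes them.\<close>

lemma computes_primrec:
  assumes 0: "computes A Gs (S 0)"
    and S: "computes A (fst # (\<lambda>u. S (fst u) (snd u)) # map (\<lambda>G u. G (snd u)) Gs)
              (\<lambda>u. S (Suc (fst u)) (snd u))"
    and N: "computes A Gs N"
  shows "computes A Gs (\<lambda>e. S (N e) e)"
proof -
  obtain p where p: "\<And>e. eval A p (map (\<lambda>G. G e) Gs) (S 0 e)"
    using 0 by (auto simp: computes_def)
  obtain q where q: "\<And>n e. eval A q (n # S n e # map (\<lambda>G. G e) Gs) (S (Suc n) e)"
    using S by (auto simp: computes_def comp_def)
  have "eval A (PrimRec p q) (n # map (\<lambda>G. G e) Gs) (S n e)" for n e
    by (induction n) (auto intro: eval.intros p q)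
  then have "computes A (N # Gs) (\<lambda>e. S (N e) e)"
    unfolding computes_def by (auto intro!: exI[of _ "PrimRec p q"])
  then show ?thesis
    by (rule computes_cut) (auto intro: N)
qed

section \<open>Arithmetic, decidable predicates, search and pairing\<close>

lemma computes_add:
  assumes "computes A Gs F" "computes A Gs G" shows "computes A Gs (\<lambda>e. F e + G e)"
  by (rule computes_primrec[where S = "\<lambda>n e. F e + n", OF _ _ assms(2)])
    (auto intro!: assms(1) computes_Suc)

lemma computes_mult:
  assumes "computes A Gs F" "computes A Gs G" shows "computes A Gs (\<lambda>e. F e * G e)"
proof (rule computes_app2[OF _ assms])
  show "computes A [fst, snd] (\<lambda>u. fst u * snd u)"
    by (rule computes_primrec[where S = "\<lambda>n e. fst e * n"])
      (auto intro!: computes_add)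
qed

lemma computes_diff:
  assumes "computes A Gs F" "computes A Gs G" shows "computes A Gs (\<lambda>e. F e - G e)"
proof (rule computes_app2[OF _ assms])
  have pred: "computes A [\<lambda>x. x] (\<lambda>x. x - 1)"
    by (rule computes_primrec[where S = "\<lambda>n e. n - 1"])
      auto
  show "computes A [fst, snd] (\<lambda>u. fst u - snd u)"
  proof (rule computes_primrec[where S = "\<lambda>n e. fst e - n"])
    let ?Gs = "fst # (\<lambda>u. fst (snd u) - fst u) # map (\<lambda>G u. G (snd u)) [fst, snd]"
    show "computes A ?Gs (\<lambda>u. fst (snd u) - Suc (fst u))"
      using computes_app[OF pred, of ?Gs "\<lambda>u. fst (snd u) - fst u"] by simp
  qed auto
qed

lemma decides_not:
  assumes "decides A Gs P" shows "decides A Gs (\<lambda>e. \<not> P e)"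
proof -
  have "computes A Gs (\<lambda>e. 1 - of_bool (P e))"
    by (intro computes_diff computes_const assms)
  also have "(\<lambda>e. 1 - of_bool (P e)) = (\<lambda>e. of_bool (\<not> P e) :: nat)"
    by auto
  finally show ?thesis .
qed

lemma decides_and: "decides A Gs P \<Longrightarrow> decides A Gs Q \<Longrightarrow> decides A Gs (\<lambda>e. P e \<and> Q e)"
  using computes_mult[of A Gs "\<lambda>e. of_bool (P e)" "\<lambda>e. of_bool (Q e)"] by (simp add: of_bool_conj)

lemma decides_or: "decides A Gs P \<Longrightarrow> decides A Gs Q \<Longrightarrow> decides A Gs (\<lambda>e. P e \<or> Q e)"
  using decides_not[OF decides_and[OF decides_not decides_not, of A Gs P Q]] by simp

lemma computes_if:
  assumes "decides A Gs P" "computes A Gs F" "computes A Gs G"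
  shows "computes A Gs (\<lambda>e. if P e then F e else G e)"
proof -
  have "computes A Gs (\<lambda>e. of_bool (P e) * F e + of_bool (\<not> P e) * G e)"
    by (intro computes_add computes_mult decides_not assms)
  also have "(\<lambda>e. of_bool (P e) * F e + of_bool (\<not> P e) * G e) = (\<lambda>e. if P e then F e else G e)"
    by auto
  finally show ?thesis .
qed

lemma decides_less:
  assumes "computes A Gs F" "computes A Gs G" shows "decides A Gs (\<lambda>e. F e < G e)"
proof -
  \<comment> \<open>With truncated subtraction, \<open>1 - (1 - x)\<close> is the sign of
    \<open>x\<close>.\<close>
  have "computes A Gs (\<lambda>e. 1 - (1 - (G e - F e)))"
    by (intro computes_diff computes_const assms)
  also have "(\<lambda>e. 1 - (1 - (G e - F e))) = (\<lambda>e. of_bool (F e < G e))"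
    by auto
  finally show ?thesis .
qed

lemma decides_le:
  assumes "computes A Gs F" "computes A Gs G" shows "decides A Gs (\<lambda>e. F e \<le> G e)"
  using decides_not[OF decides_less[OF assms(2,1)]] by (simp add: not_less)

lemma decides_eq:
  assumes "computes A Gs F" "computes A Gs G" shows "decides A Gs (\<lambda>e. F e = G e)"
  using decides_and[OF decides_le[OF assms] decides_le[OF assms(2,1)]] by (simp add: order_eq_iff)

lemma card_less_Suc: "card {t. t < Suc n \<and> P t} = card {t. t < n \<and> P t} + of_bool (P n)"
proof -
  have "{t. t < Suc n \<and> P t} = (if P n then insert n {t. t < n \<and> P t} else {t. t < n \<and> P t})"
    by (auto simp: less_Suc_eq)
  then show ?thesis by simp
qed

text \<open>Bounded counting by recursion on the bound. It yields bounded quantifiers and, in a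
  copy, the number of predecessors seen so far.\<close>

lemma computes_card:
  assumes P: "decides A (fst # map (\<lambda>G u. G (snd u)) Gs) (\<lambda>u. P (fst u) (snd u))"
    and N: "computes A Gs N"
  shows "computes A Gs (\<lambda>e. card {t. t < N e \<and> P t e})"
proof (rule computes_primrec[where S = "\<lambda>n e. card {t. t < n \<and> P t e}", OF _ _ N])
  show "computes A (fst # (\<lambda>u. card {t. t < fst u \<and> P t (snd u)}) # map (\<lambda>G u. G (snd u)) Gs)
      (\<lambda>u. card {t. t < Suc (fst u) \<and> P t (snd u)})"
    unfolding card_less_Suc by (rule computes_add) (auto intro: computes_mono[OF P])
qed simp

lemma decides_bex:
  assumes "decides A (fst # map (\<lambda>G u. G (snd u)) Gs) (\<lambda>u. P (fst u) (snd u))" "computes A Gs N"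
  shows "decides A Gs (\<lambda>e. \<exists>t<N e. P t e)"
proof -
  have "(\<exists>t<N e. P t e) \<longleftrightarrow> 0 < card {t. t < N e \<and> P t e}" for e
    by (auto simp: card_gt_0_iff)
  then show ?thesis
    using decides_less[OF computes_const computes_card[OF assms], of 0] by simp
qed

text \<open>\<open>Mu\<close> stops at the first value \<open>0\<close>, so it runs on the negation
  of \<open>P\<close>. That test is total, hence defined and positive at all earlier numbers, and
  \<open>ex\<close> makes the search end.\<close>

lemma computes_Least:
  assumes P: "decides A (fst # map (\<lambda>G u. G (snd u)) Gs) (\<lambda>u. P (fst u) (snd u))"
    and ex: "\<And>e. \<exists>n. P n e"
  shows "computes A Gs (\<lambda>e. LEAST n. P n e)"
proof -
  obtain p where "\<And>u. eval A p (map (\<lambda>G. G u) (fst # map (\<lambda>G u. G (snd u)) Gs))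
      (of_bool (\<not> P (fst u) (snd u)))"
    using decides_not[OF P] unfolding computes_def by blast
  from this[of "(n, e)" for n e]
  have p: "\<And>n e. eval A p (n # map (\<lambda>G. G e) Gs) (of_bool (\<not> P n e))"
    by (simp add: comp_def)
  have "eval A (Mu p) (map (\<lambda>G. G e) Gs) (LEAST n. P n e)" for e
  proof (rule eval_Mu)
    show "eval A p ((LEAST n. P n e) # map (\<lambda>G. G e) Gs) 0"
      using p[of "LEAST n. P n e" e] LeastI_ex[OF ex[of e]] by simp
    show "\<forall>k<LEAST n. P n e. \<exists>y>0. eval A p (k # map (\<lambda>G. G e) Gs) y"
      using p[of _ e] not_less_Least by (metis of_bool_eq(2) zero_less_one)
  qed
  then show ?thesis unfolding computes_def by blast
qed

lemma computes_prod_encode: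
  assumes "computes A Gs F" "computes A Gs G"
  shows "computes A Gs (\<lambda>e. prod_encode (F e, G e))"
proof -
  have tri: "computes A [\<lambda>x. x] triangle"
    by (rule computes_primrec[where S = "\<lambda>n e. triangle n"])
      (auto intro!: computes_Suc computes_add)
  show ?thesis
    unfolding prod_encode_def
    by (auto intro!: computes_add computes_app[OF tri] assms)
qed

text \<open>Neither component exceeds the code \<open>z\<close>, so a candidate for one of them is
  tested by searching for the other below \<open>Suc z\<close>.\<close>

lemma computes_prod_decode:
  assumes "computes A Gs F"
  shows "computes A Gs (\<lambda>e. fst (prod_decode (F e)))" "computes A Gs (\<lambda>e. snd (prod_decode (F e)))"
proof -
  have ex1: "(\<exists>b<Suc z. prod_encode (a, b) = z) \<longleftrightarrow> a = fst (prod_decode z)" for a z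
    by (metis le_prod_encode_2 less_Suc_eq_le prod.collapse fst_conv prod_decode_inverse prod_encode_inverse)
  have ex2: "(\<exists>a<Suc z. prod_encode (a, b) = z) \<longleftrightarrow> b = snd (prod_decode z)" for b z
    by (metis le_prod_encode_1 less_Suc_eq_le prod.collapse snd_conv prod_decode_inverse prod_encode_inverse)
  have "computes A [\<lambda>x. x] (\<lambda>z. LEAST a. \<exists>b<Suc z. prod_encode (a, b) = z)"
    by (rule computes_Least, intro decides_bex decides_eq computes_prod_encode computes_Suc)
      (auto simp: ex1)
  from computes_app[OF this assms] show "computes A Gs (\<lambda>e. fst (prod_decode (F e)))"
    by (simp add: ex1 Least_eq)
  have "computes A [\<lambda>x. x] (\<lambda>z. LEAST b. \<exists>a<Suc z. prod_encode (a, b) = z)"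
    by (rule computes_Least, intro decides_bex decides_eq computes_prod_encode computes_Suc)
      (auto simp: ex2)
  from computes_app[OF this assms] show "computes A Gs (\<lambda>e. snd (prod_decode (F e)))"
    by (simp add: ex2 Least_eq)
qed

section \<open>Turing degrees\<close>

fun replace_query :: "recf \<Rightarrow> recf \<Rightarrow> recf" where
  "replace_query q Query = q"
| "replace_query q (Comp p ps) = Comp (replace_query q p) (map (replace_query q) ps)"
| "replace_query q (PrimRec p r) = PrimRec (replace_query q p) (replace_query q r)"
| "replace_query q (Mu p) = Mu (replace_query q p)"
| "replace_query q p = p"

text \<open>Only the rule for \<open>Query\<close> consults the oracle, and there \<open>q\<close>
  returns the same answer from \<open>A\<close>. All other rules carry over by induction.\<close>

lemma eval_replace_query:
  assumes q: "\<And>x. eval A q [x] (of_bool (x \<in> B))"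
  shows "eval B p xs y \<Longrightarrow> eval A (replace_query q p) xs y"
proof (induction rule: eval.induct)
  case (eval_Comp xs gs ys h z)
  then show ?case by (auto intro!: eval.eval_Comp simp: list_all2_conv_all_nth)
next
  case (eval_Mu g n xs)
  then show ?case by (auto intro!: eval.eval_Mu)
qed (use q in \<open>auto intro: eval.intros simp del: of_bool_eq_iff\<close>)

lemma computes_trans:
  assumes "decides A [\<lambda>x. x] (\<lambda>x. x \<in> B)" "computes B Gs F"
  shows "computes A Gs F"
  using assms eval_replace_query unfolding computes_def by (metis list.simps(8,9))

lemma computes_of_empty: "computes {} Gs F \<Longrightarrow> computes A Gs F"
  by (rule computes_trans) simp_all

lemma computes_computable_fun:
  assumes "computable_fun f" "computes A Gs F" shows "computes A Gs (\<lambda>e. f (F e))"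
  using computes_app[OF computes_of_empty] assms unfolding computable_fun_iff by blast

lemma turing_degree_eqI:
  assumes "turing_equivalent A B" shows "turing_degree A = turing_degree B"
proof -
  have "turing_reducible A C" if "turing_reducible A B" "turing_reducible B C" for A B C
    using that computes_trans unfolding turing_reducible_iff by blast
  then show ?thesis
    using assms unfolding turing_degree_def turing_equivalent_def by blast
qed

section \<open>Computable copies\<close>

locale computable_copy =
  fixes h :: "nat \<Rightarrow> nat" and R :: "nat \<Rightarrow> nat \<Rightarrow> bool"
  assumes rel: "computable_rel R" and iso: "omega_iso h R"
begin

lemma h_eq_iff [simp]: "h x = h y \<longleftrightarrow> x = y"
  using iso by (auto simp: omega_iso_def bij_def inj_eq)

lemma R_iff [simp]: "R (h x) (h y) \<longleftrightarrow> x < y"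
  using iso by (auto simp: omega_iso_def)

lemma h_cases: obtains x where "a = h x"
  using iso by (auto simp: omega_iso_def bij_def)

lemma decides_R: "computes A Gs F \<Longrightarrow> computes A Gs G \<Longrightarrow> decides A Gs (\<lambda>e. R (F e) (G e))"
  by (rule computes_app2) (use rel in \<open>auto simp: computable_rel_iff intro: computes_of_empty\<close>)

text \<open>What is counted is the part below \<open>N\<close> of the set of the \<open>k\<close>
  predecessors of \<open>h k\<close>. The count reaches \<open>k\<close> precisely when none is
  missing, which a search can detect.\<close>

lemma card_below:
  "card {c. c < N \<and> R c (h k)} = k \<longleftrightarrow> h ` {..<k} \<subseteq> {..<N}"
  "card {c. c < N \<and> R c (h k)} \<le> k"
proof -
  have *: "{c. c < N \<and> R c (h k)} = h ` {..<k} \<inter> {..<N}"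
  proof (intro set_eqI)
    fix c show "c \<in> {c. c < N \<and> R c (h k)} \<longleftrightarrow> c \<in> h ` {..<k} \<inter> {..<N}"
      by (cases rule: h_cases[of c]) auto
  qed
  have card: "card (h ` {..<k}) = k"
    by (subst card_image) (auto intro: inj_onI)
  show "card {c. c < N \<and> R c (h k)} \<le> k"
    using card card_mono[of "h ` {..<k}" "h ` {..<k} \<inter> {..<N}"] by (simp add: *)
  show "card {c. c < N \<and> R c (h k)} = k \<longleftrightarrow> h ` {..<k} \<subseteq> {..<N}"
    unfolding * using card card_subset_eq[of "h ` {..<k}" "h ` {..<k} \<inter> {..<N}"]
    by (metis Int_lower1 finite_imageI finite_lessThan inf.absorb_iff1)
qed

lemma ex_card_below: "\<exists>N. card {c. c < N \<and> R c (h k)} = k"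
proof -
  have "h ` {..<k} \<subseteq> {..<Suc (Max (insert 0 (h ` {..<k})))}"
    by (auto simp: less_Suc_eq_le)
  then show ?thesis using card_below(1) by blast
qed

lemma computes_h_below:
  assumes K: "computes A Gs K" and B: "computes A Gs (\<lambda>e. h (K e))"
    and I: "computes A Gs I" and le: "\<And>e. I e \<le> K e"
  shows "computes A Gs (\<lambda>e. h (I e))"
proof -
  define N where "N e = (LEAST n. card {c. c < n \<and> R c (h (K e))} = K e)" for e
  have N: "h ` {..<K e} \<subseteq> {..<N e}" for e
    unfolding N_def card_below(1)[symmetric] using ex_card_below by (rule LeastI_ex)
  have cN: "computes A Gs N"
    unfolding N_def
    by (rule computes_Least, intro decides_eq computes_card decides_R computes_lift K B)
      (auto intro: ex_card_below)
  \<comment> \<open>For \<open>c\<close> not above \<open>h (K e)\<close>, all predecessors lie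
    below \<open>N e\<close>, so the count is the exact position of \<open>c\<close>. For larger
    \<open>c\<close> the count may be too small; the first conjunct excludes them.\<close>
  have iff: "\<not> R (h (K e)) c \<and> card {c'. c' < N e \<and> R c' c} = I e \<longleftrightarrow> c = h (I e)" for c e
  proof (cases rule: h_cases[of c])
    case (1 x)
    have "card {c'. c' < N e \<and> R c' (h x)} = x" if "x \<le> K e"
      using N[of e] that unfolding card_below(1) by (meson image_mono lessThan_subset_iff order_trans)
    then show ?thesis using le[of e] by (auto simp: 1 not_less)
  qed
  have "computes A Gs (\<lambda>e. LEAST c. \<not> R (h (K e)) c \<and> card {c'. c' < N e \<and> R c' c} = I e)"
    by (rule computes_Least, intro decides_and decides_not decides_eq computes_card decides_R computes_lift B I cN)
      (auto simp: iff)
  then show ?thesis by (simp add: iff Least_eq)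
qed

section \<open>Positions in a copy and the graph of \<open>f\<close>\<close>

definition pos :: "nat \<Rightarrow> nat" where "pos a = (LEAST x. h x = a)"

lemma pos_h [simp]: "pos (h x) = x"
  by (simp add: pos_def Least_eq)

lemma computes_pos:
  assumes h: "computes A [\<lambda>x. x] h" and F: "computes A Gs F"
  shows "computes A Gs (\<lambda>e. pos (F e))"
proof (rule computes_app[OF _ F])
  have "\<exists>x. h x = a" for a by (metis h_cases)
  then show "computes A [\<lambda>x. x] pos"
    unfolding pos_def by (intro computes_Least decides_eq computes_app[OF h]) auto
qed

lemma prod_encode_in_graph_image: "prod_encode (h x, b) \<in> graph_image h f \<longleftrightarrow> b = h (f x)"
  by (auto simp: graph_image_def prod_encode_eq)

lemma graph_image_reducible:
  assumes f: "computable_fun f" and h: "computes A [\<lambda>x. x] h"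
  shows "turing_reducible (graph_image h f) A"
proof -
  have "z \<in> graph_image h f \<longleftrightarrow> h (f (pos (fst (prod_decode z)))) = snd (prod_decode z)" for z
  proof (cases rule: h_cases[of "fst (prod_decode z)"])
    case (1 x)
    then have "z = prod_encode (h x, snd (prod_decode z))" by (metis prod.collapse prod_decode_inverse)
    then show ?thesis using 1 prod_encode_in_graph_image[of x "snd (prod_decode z)" f] by auto
  qed
  moreover have "decides A [\<lambda>x. x] (\<lambda>z. h (f (pos (fst (prod_decode z)))) = snd (prod_decode z))"
    by (intro decides_eq computes_app[OF h] computes_computable_fun[OF f] computes_pos[OF h]
        computes_prod_decode) auto
  ultimately show ?thesis by (simp add: turing_reducible_iff)
qed

lemma computes_iso_graph_image:
  assumes f: "computable_fun f" and nqb: "\<not> quasi_block f"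
  shows "computes (graph_image h f) [\<lambda>x. x] h"
proof -
  let ?A = "graph_image h f"
  obtain k0 where k0: "\<And>m. k0 \<le> m \<Longrightarrow> \<exists>x\<le>m. m < f x"
    using nqb unfolding quasi_block_def by (meson not_le)
  define next_arg where "next_arg k = (LEAST x. k < f x)" for k
  \<comment> \<open>Each stage moves to the value of \<open>f\<close> at the least argument sent
    beyond the current stage, so the graph of \<open>f\<close> links a known argument to the next
    stage.\<close>
  define k where "k j = ((\<lambda>k. f (next_arg k)) ^^ j) k0" for j
  have k_Suc: "k (Suc j) = f (next_arg (k j))" for j by (simp add: k_def)
  have ex: "\<exists>x. m < f x" for m
    using k0[of "max m k0"] by auto
  have less: "m < f (next_arg m)" for m
    unfolding next_arg_def by (rule LeastI_ex[OF ex])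
  have k_ge: "k0 + j \<le> k j" for j
  proof (induction j)
    case (Suc j)
    then show ?case using less[of "k j"] by (simp add: k_Suc)
  qed (simp add: k_def)
  \<comment> \<open>Since \<open>k j\<close> is at least \<open>k0\<close>, some argument up to
    \<open>k j\<close> has a value beyond \<open>k j\<close>, and the least one is no larger. Its
    image under \<open>h\<close> is therefore determined by \<open>h (k j)\<close>.\<close>
  have arg_le: "next_arg (k j) \<le> k j" for j
    using k0[of "k j"] k_ge[of j] unfolding next_arg_def
    by (meson Least_le add_leD1 order_trans)
  have c_next: "computes ?A [\<lambda>x. x] next_arg"
    unfolding next_arg_def by (intro computes_Least decides_less computes_computable_fun[OF f] ex) auto
  have ck: "computes ?A [\<lambda>x. x] k"
    by (rule computes_primrec[where S = "\<lambda>n e. k n"])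
      (simp_all add: k_Suc computes_computable_fun[OF f] computes_app[OF c_next])
  \<comment> \<open>The recursion starts from the number \<open>h k0\<close>, which is hard-wired
    into the program.\<close>
  have chk: "computes ?A [\<lambda>x. x] (\<lambda>j. h (k j))"
  proof (rule computes_primrec[where S = "\<lambda>n e. h (k n)"])
    let ?Gs = "fst # (\<lambda>u. h (k (fst u))) # map (\<lambda>G u. G (snd u)) [\<lambda>x::nat. x]"
    have "computes ?A ?Gs (\<lambda>u. h (next_arg (k (fst u))))"
      by (rule computes_h_below[where K = "\<lambda>u. k (fst u)"])
        (simp_all add: computes_app[OF ck] computes_app[OF c_next computes_app[OF ck]] arg_le)
    \<comment> \<open>Exactly one pair in the oracle has the given first component, so the search
      returns the image of the next stage.\<close>
    then have "computes ?A ?Gs (\<lambda>u. LEAST b. prod_encode (h (next_arg (k (fst u))), b) \<in> ?A)"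
      by (intro computes_Least decides_oracle computes_prod_encode computes_lift)
        (auto simp: prod_encode_in_graph_image)
    then show "computes ?A ?Gs (\<lambda>u. h (k (Suc (fst u))))"
      by (simp add: prod_encode_in_graph_image Least_eq k_Suc)
  qed (auto simp: k_def)
  \<comment> \<open>As \<open>j \<le> k j\<close>, the value \<open>h j\<close> is among those
    determined by \<open>h (k j)\<close>.\<close>
  show ?thesis
    by (rule computes_h_below[OF ck chk]) (auto intro: add_leD2[OF k_ge])
qed

section \<open>A c.e. set of the degree of the isomorphism\<close>

definition pos_subgraph :: "nat set" where
  "pos_subgraph = {prod_encode (h x, n) | x n. n \<le> x}"

lemma prod_encode_in_pos_subgraph: "prod_encode (h x, n) \<in> pos_subgraph \<longleftrightarrow> n \<le> x"
  by (auto simp: pos_subgraph_def prod_encode_eq)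

text \<open>
  The number of predecessors of \<open>a\<close> below \<open>N\<close> grows with \<open>N\<close> in steps of at most one up to
  \<open>pos a\<close>, so these counts enumerate \<open>{..pos a}\<close>.
\<close>

lemma ce_set_pos_subgraph: "ce_set pos_subgraph"
proof -
  define g where "g z = prod_encode (fst (prod_decode z),
    card {c. c < snd (prod_decode z) \<and> R c (fst (prod_decode z))})" for z
  have ivt: "\<exists>M. card {c. c < M \<and> R c a} = n" if "n \<le> card {c. c < N \<and> R c a}" for n N a
    using that
  proof (induction N)
    case (Suc N)
    show ?case
    proof (cases "n \<le> card {c. c < N \<and> R c a}")
      case False
      then have "n = card {c. c < Suc N \<and> R c a}"
        using Suc.prems by (cases "R N a") (auto simp: card_less_Suc)
      then show ?thesis by blast
    qed (rule Suc.IH)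
  qed auto
  have "pos_subgraph = range g"
  proof (intro equalityI subsetI)
    fix z assume "z \<in> pos_subgraph"
    then obtain x n where z: "z = prod_encode (h x, n)" "n \<le> x"
      by (auto simp: pos_subgraph_def)
    obtain M where "card {c. c < M \<and> R c (h x)} = n"
      using ivt ex_card_below z(2) by metis
    then have "z = g (prod_encode (h x, M))" by (simp add: g_def z)
    then show "z \<in> range g" by blast
  next
    fix z assume "z \<in> range g"
    then obtain y where z: "z = g y" by blast
    show "z \<in> pos_subgraph"
      by (cases rule: h_cases[of "fst (prod_decode y)"])
        (simp add: z g_def prod_encode_in_pos_subgraph card_below)
  qed
  moreover have "computes {} [\<lambda>x. x] g"
    unfolding g_def
    by (intro computes_prod_encode computes_card decides_R computes_prod_decode computes_lift) auto
  ultimately show ?thesis unfolding ce_set_def computable_fun_iff by blast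
qed

text \<open>The numbers paired with \<open>a\<close> form an initial segment whose last element is
  the position of \<open>a\<close>, so \<open>h n\<close> is the only \<open>a\<close> whose segment
  ends at \<open>n\<close>.\<close>

lemma computes_iso_pos_subgraph: "computes pos_subgraph [\<lambda>x. x] h"
proof -
  have *: "prod_encode (a, n) \<in> pos_subgraph \<and> prod_encode (a, Suc n) \<notin> pos_subgraph \<longleftrightarrow> a = h n" for a n
    by (cases rule: h_cases[of a]) (auto simp: prod_encode_in_pos_subgraph)
  have "computes pos_subgraph [\<lambda>x. x]
    (\<lambda>n. LEAST a. prod_encode (a, n) \<in> pos_subgraph \<and> prod_encode (a, Suc n) \<notin> pos_subgraph)"
    by (rule computes_Least, intro decides_and decides_not decides_oracle computes_prod_encode computes_Suc)
      (auto simp: *)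
  then show ?thesis by (simp add: * Least_eq)
qed

lemma pos_subgraph_reducible:
  assumes h: "computes A [\<lambda>x. x] h"
  shows "turing_reducible pos_subgraph A"
proof -
  have "z \<in> pos_subgraph \<longleftrightarrow> snd (prod_decode z) \<le> pos (fst (prod_decode z))" for z
  proof (cases rule: h_cases[of "fst (prod_decode z)"])
    case (1 x)
    then have "z = prod_encode (h x, snd (prod_decode z))" by (metis prod.collapse prod_decode_inverse)
    then show ?thesis using 1 prod_encode_in_pos_subgraph[of x "snd (prod_decode z)"] by auto
  qed
  moreover have "decides A [\<lambda>x. x] (\<lambda>z. snd (prod_decode z) \<le> pos (fst (prod_decode z)))"
    by (intro decides_le computes_pos[OF h] computes_prod_decode) auto
  ultimately show ?thesis by (simp add: turing_reducible_iff)
qed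

end

section \<open>Copies ordered by a key\<close>

locale key_copy =
  fixes key :: "nat \<Rightarrow> nat"
  assumes inj: "inj key" and computable: "computable_fun key"
begin

definition iso :: "nat \<Rightarrow> nat" where "iso n = inv key (enumerate (range key) n)"

lemma infinite_range: "infinite (range key)"
  using inj by (simp add: finite_image_iff)

lemma key_iso [simp]: "key (iso n) = enumerate (range key) n"
  unfolding iso_def using enumerate_in_set[OF infinite_range] by (rule f_inv_into_f)

lemmas computes_key = computes_computable_fun[OF computable]

sublocale computable_copy iso "\<lambda>a b. key a < key b"
proof
  show "computable_rel (\<lambda>a b. key a < key b)"
    unfolding computable_rel_iff by (intro decides_less computes_key) auto
  have "inj iso"
    by (metis injI key_iso enumerate_mono_iff infinite_range less_irrefl linorder_neqE_nat)
  moreover have "\<exists>n. a = iso n" for a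
    by (metis enumerate_Ex infinite_range inj injD key_iso rangeI)
  ultimately show "omega_iso iso (\<lambda>a b. key a < key b)"
    by (auto simp: omega_iso_def bij_def infinite_range)
qed

text \<open>The increasing enumeration of the keys dominates the identity, so a key \<open>y\<close>
  must occur among the first \<open>Suc y\<close> elements of the copy.\<close>

lemma range_key_reducible:
  assumes h: "computes A [\<lambda>x. x] iso"
  shows "decides A [\<lambda>x. x] (\<lambda>y. y \<in> range key)"
proof -
  have "y \<in> range key \<longleftrightarrow> (\<exists>n<Suc y. key (iso n) = y)" for y
  proof
    assume "y \<in> range key"
    then obtain n where n: "enumerate (range key) n = y"
      using enumerate_Ex[OF infinite_range] by blast
    then have "n \<le> y" using le_enumerate[OF infinite_range, of n] by simp
    with n show "\<exists>n<Suc y. key (iso n) = y" by (auto intro!: exI[of _ n])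
  qed (metis rangeI)
  moreover have "decides A [\<lambda>x. x] (\<lambda>y. \<exists>n<Suc y. key (iso n) = y)"
    by (intro decides_bex decides_eq computes_key computes_app[OF h] computes_Suc) auto
  ultimately show ?thesis by simp
qed

text \<open>Once the range of \<open>key\<close> is decidable, the keys below \<open>key b\<close>
  can be counted, and their number is the position of \<open>b\<close>.\<close>

lemma computes_iso:
  assumes K: "decides A [\<lambda>x. x] (\<lambda>y. y \<in> range key)"
  shows "computes A [\<lambda>x. x] iso"
proof -
  have card: "card {y. y < key (iso m) \<and> y \<in> range key} = m" for m
  proof -
    have "y < key (iso m) \<and> y \<in> range key \<longleftrightarrow> y \<in> enumerate (range key) ` {..<m}" for y
    proof
      assume y: "y < key (iso m) \<and> y \<in> range key"
      then obtain n where "enumerate (range key) n = y"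
        using enumerate_Ex[OF infinite_range] by blast
      moreover from this y have "n < m"
        using enumerate_mono_iff[OF infinite_range, of n m] by (metis key_iso)
      ultimately show "y \<in> enumerate (range key) ` {..<m}" by blast
    next
      assume "y \<in> enumerate (range key) ` {..<m}"
      then obtain n where "y = enumerate (range key) n" "n < m" by blast
      then show "y < key (iso m) \<and> y \<in> range key"
        using enumerate_in_set[OF infinite_range, of n] by (simp add: infinite_range)
    qed
    then have "{y. y < key (iso m) \<and> y \<in> range key} = enumerate (range key) ` {..<m}" by blast
    moreover have "inj_on (enumerate (range key)) {..<m}"
      using inj_enumerate[OF infinite_range] by (rule inj_on_subset) simp
    ultimately show ?thesis by (simp only: card_image card_lessThan)
  qed
  have *: "card {y. y < key b \<and> y \<in> range key} = n \<longleftrightarrow> b = iso n" for b n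
    by (cases rule: h_cases[of b]) (simp add: card del: key_iso)
  have "computes A [\<lambda>x. x] (\<lambda>n. LEAST b. card {y. y < key b \<and> y \<in> range key} = n)"
    by (rule computes_Least, intro decides_eq computes_card computes_app[OF K] computes_key)
      (auto simp: *)
  then show ?thesis by (simp add: * Least_eq)
qed

end

section \<open>Injective enumeration without change of degree\<close>

text \<open>Stages repeating an old value of \<open>g\<close> get fresh odd numbers, so that \<open>dedup g\<close> is injective.\<close>

definition dedup :: "(nat \<Rightarrow> nat) \<Rightarrow> nat \<Rightarrow> nat" where
  "dedup g s = (if \<exists>t<s. g t = g s then Suc (2 * s) else 2 * g s)"

lemma inj_dedup: "inj (dedup g)"
proof (rule injI)
  fix s t assume eq: "dedup g s = dedup g t"
  have "Suc (2 * a) \<noteq> 2 * b" for a b :: nat by presburger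
  with eq show "s = t"
    unfolding dedup_def by (auto split: if_splits) (metis linorder_neqE_nat)+
qed

lemma computable_dedup:
  assumes "computable_fun g" shows "computable_fun (dedup g)"
  unfolding computable_fun_iff dedup_def
  by (intro computes_if decides_bex decides_eq computes_Suc computes_mult computes_const
      computes_computable_fun[OF assms]) auto

lemma double_in_range_dedup: "2 * w \<in> range (dedup g) \<longleftrightarrow> w \<in> range g"
proof
  assume "2 * w \<in> range (dedup g)"
  then obtain s where s: "2 * w = dedup g s" by blast
  have "2 * w \<noteq> Suc (2 * s)" by presburger
  with s show "w \<in> range g" by (auto simp: dedup_def split: if_splits)
next
  assume "w \<in> range g"
  \<comment> \<open>The least stage enumerating \<open>w\<close> is not a repetition, so it receives
    the even number \<open>2 * w\<close>.\<close>
  then obtain s where s: "g s = w" "\<And>t. t < s \<Longrightarrow> g t \<noteq> w"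
    using exists_least_iff[of "\<lambda>s. g s = w"] by auto
  then have "2 * w = dedup g s" by (auto simp: dedup_def)
  then show "2 * w \<in> range (dedup g)" by blast
qed

lemma odd_in_range_dedup: "Suc (2 * s) \<in> range (dedup g) \<longleftrightarrow> (\<exists>t<s. g t = g s)"
proof
  assume "Suc (2 * s) \<in> range (dedup g)"
  then obtain s' where s': "Suc (2 * s) = dedup g s'" by blast
  have "Suc (2 * s) \<noteq> 2 * g s'" by presburger
  with s' show "\<exists>t<s. g t = g s" by (auto simp: dedup_def split: if_splits)
next
  assume "\<exists>t<s. g t = g s"
  then have "Suc (2 * s) = dedup g s" by (auto simp: dedup_def)
  then show "Suc (2 * s) \<in> range (dedup g)" by blast
qed

text \<open>The even part of the range is a copy of \<open>range g\<close>, which the oracle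
  answers. The odd part records repetitions and is decided by inspecting finitely many
  stages.\<close>

lemma range_dedup_reducible:
  assumes g: "computable_fun g"
  shows "decides (range g) [\<lambda>x. x] (\<lambda>y. y \<in> range (dedup g))"
proof -
  define V where "V = range g"
  have "y \<in> range (dedup g) \<longleftrightarrow>
    (\<exists>s<Suc y. (y = 2 * s \<and> s \<in> V) \<or> (y = Suc (2 * s) \<and> (\<exists>t<s. g t = g s)))" for y
  proof (cases "even y")
    case True
    then obtain s where "y = 2 * s" by blast
    then show ?thesis
      by (auto simp: double_in_range_dedup double_not_eq_Suc_double simp flip: V_def)
  next
    case False
    then obtain s where "y = Suc (2 * s)" by (auto elim: oddE)
    then show ?thesis
      by (auto simp: odd_in_range_dedup Suc_double_not_eq_double intro!: exI[of _ s])
  qed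
  moreover have "decides V [\<lambda>x. x]
    (\<lambda>y. \<exists>s<Suc y. (y = 2 * s \<and> s \<in> V) \<or> (y = Suc (2 * s) \<and> (\<exists>t<s. g t = g s)))"
    by (intro decides_bex decides_or decides_and decides_eq decides_oracle computes_Suc computes_mult
        computes_const computes_computable_fun[OF g]) auto
  ultimately show ?thesis by (simp add: V_def)
qed

text \<open>The empty set is not a range, but it has the degree of \<open>{0}\<close>, both sets
  being decidable, so the constant function \<open>0\<close> represents it.\<close>

lemma ce_degree_cases:
  assumes "ce_set W"
  obtains g where "computable_fun g" "turing_degree W = turing_degree (range g)"
proof (cases "W = {}")
  case True
  have "turing_degree {} = turing_degree (range (\<lambda>_. 0))"
    by (rule turing_degree_eqI)
      (auto simp: turing_equivalent_def turing_reducible_iff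
        intro!: decides_eq computes_const[of _ _ 0, simplified])
  moreover have "computable_fun (\<lambda>_. 0)"
    by (simp add: computable_fun_iff)
  ultimately show ?thesis using that True by metis
next
  case False
  then show ?thesis using assms that by (auto simp: ce_set_def)
qed

section \<open>The two inclusions between the spectrum and the c.e. degrees\<close>

theorem theorem4:
  fixes f :: "nat \<Rightarrow> nat"
  assumes "computable_fun f"
    and "\<not> quasi_block f"
  shows "degree_spectrum f = ce_degrees"
proof (intro equalityI subsetI)
  fix d assume "d \<in> degree_spectrum f"
  then obtain h R where d: "d = turing_degree (graph_image h f)"
    and hR: "computable_rel R" "omega_iso h R"
    by (auto simp: degree_spectrum_def)
  interpret computable_copy h R by unfold_locales (fact hR)+
  have "d = turing_degree pos_subgraph"
    unfolding d
    by (rule turing_degree_eqI) (simp add: turing_equivalent_def graph_image_reducible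
        pos_subgraph_reducible computes_iso_pos_subgraph computes_iso_graph_image assms)
  then show "d \<in> ce_degrees"
    using ce_set_pos_subgraph by (auto simp: ce_degrees_def)
next
  fix d assume "d \<in> ce_degrees"
  then obtain g where g: "computable_fun g" and d: "d = turing_degree (range g)"
    by (auto simp: ce_degrees_def elim: ce_degree_cases)
  interpret key_copy "dedup g"
    by unfold_locales (simp_all add: inj_dedup computable_dedup g)
  have "turing_reducible (graph_image iso f) (range g)"
    by (intro graph_image_reducible computes_iso range_dedup_reducible assms g)
  moreover have "turing_reducible (range g) (graph_image iso f)"
  proof -
    \<comment> \<open>The graph of \<open>f\<close> in the copy computes \<open>iso\<close>, hence
      the range of \<open>dedup g\<close>, whose even part encodes \<open>range g\<close>.\<close>
    have "decides (graph_image iso f) [\<lambda>x. x] (\<lambda>w. 2 * w \<in> range (dedup g))"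
      by (intro computes_app[OF range_key_reducible] computes_iso_graph_image assms
          computes_mult computes_const) simp
    then show ?thesis by (simp add: double_in_range_dedup turing_reducible_iff)
  qed
  ultimately have "d = turing_degree (graph_image iso f)"
    unfolding d by (intro turing_degree_eqI) (simp add: turing_equivalent_def)
  then show "d \<in> degree_spectrum f"
    using rel iso by (auto simp: degree_spectrum_def)
qed

end
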